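(* Let $X=\ell^\infty_0$, so that $X^*=\ell^1$ and $X^{**}=\ell^\infty$. The operator $$A:\ell^1\to\ell^\infty_0,\qquad x\mapsto G(x)+\langle x,e\rangle e,$$ is linear, monotone, injective and everywhere defined on $\ell^1$, and there exists $x^{**}_0\in \ell^\infty\setminus\ell^\infty_0$ such that $$\sup_{x\in\ell^1}\ \langle x,x^{**}_0\rangle-\langle A(x),x\rangle<\infty.$$ Hence $A^{-1}:\ell^\infty_0\rightrightarrows\ell^1$ is a maximal monotone operator of type (D), and the inverse (an operator $\ell^1\rightrightarrows\ell^\infty$) of its unique maximal monotone extension to the bidual (an operator $\ell^\infty\rightrightarrows\ell^1$) is not of type (D).
   Context: Here $\ell^1=\ell^1(\mathbb N)$ and $\ell^\infty=\ell^\infty(\mathbb N)$ are the real sequence spaces (indices $n=1,2,\dots$) and $\ell^\infty_0=\{x\in\ell^\infty:\lim_{i\to\infty}x_i=0\}$, with the canonical identifications $(\ell^\infty_0)^*=\ell^1$ and $(\ell^1)^*=\ell^\infty$. Put $e=(1,1,1,\dots)\in\ell^\infty$, and let $G:\ell^1\to\ell^\infty$ be Gossez's operator $(Gx)_n=\sum_{k>n}x_k-\sum_{k<n}x_k$. A point-to-set operator $S:U\rightrightarrows V$ is a map from $U$ to the power set of $V$; its graph is $\mathrm{Gr}(S)=\{(u,v)\in U\times V : v\in S(u)\}$, and its inverse $S^{-1}:V\rightrightarrows U$ is $S^{-1}(v)=\{u\in U: v\in S(u)\}$. For a real Banach space $Y$, $Y^*$ is the topological dual, $Y$ is identified with its canonical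 image in $Y^{**}$, and $\langle y,y^*\rangle=\langle y^*,y\rangle=y^*(y)$ for $y\in Y$, $y^*\in Y^*$. An operator $S:Y\rightrightarrows Y^*$ is monotone if $\langle x-y,x^*-y^*\rangle\ge 0$ for all $(x,x^* ),(y,y^* )\in\mathrm{Gr}(S)$; an operator $S:Y^{**}\rightrightarrows Y^*$ is monotone if $\langle x^*-y^*,x^{**}-y^{**}\rangle\ge0$ for all $(x^{**},x^* ),(y^{**},y^* )\in\mathrm{Gr}(S)$. It is maximal monotone if it is monotone and its graph is maximal, with respect to inclusion, among the graphs of monotone operators in $Y\times Y^*$ (respectively $Y^{**}\times Y^*$). An operator $A:X^*\to X$ is monotone if $\langle A(x^* )-A(y^* ),x^*-y^*\rangle\ge 0$ for all $x^*,y^*$ in its domain. For a maximal monotone $S:Y\rightrightarrows Y^*$, Gossez's monotone closure $\widetilde S:Y^{**}\rightrightarrows Y^*$ is the operator with graph $\mathrm{Gr}(\widetilde S)=\{(y^{**},y^* )\in Y^{**}\times Y^* : \langle y^*-z^*,y^{**}-z\rangle\ge 0\ \ \forall (z,z^* )\in\mathrm{Gr}(S)\}$. The operator $S$ is of (Gossez) type (D) if for any $(y^{**},y^* )\in\mathrm{Gr}(\widetilde S)$ there exists a bounded net $((y_i,y_i^* ))_{i\in I}$ in $\mathrm{Gr}(S)$ which converges to $(y^{**},y^* )$ in the $\sigma(Y^{**},Y^* )\times$strong topology of $Y^{**}\times Y^*$. These notions are used with $Y=\ell^\infty_0$ for $A^{-1}$, and with $Y=\ell^1$ for the inverse of its extension.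 A maximal monotone extension to the bidual of $S:Y\rightrightarrows Y^*$ is a maximal monotone operator $Y^{**}\rightrightarrows Y^*$ whose graph contains $\mathrm{Gr}(S)$ (viewed in $Y^{**}\times Y^*$). It is a known theorem of Gossez that a maximal monotone $S$ of type (D) has exactly one such extension, namely $\widetilde S$. *)

theory Defs
  imports "HOL-Analysis.Analysis"
begin

section \<open>Point-to-set operators and nets\<close>

definition graph_of :: "('u \<Rightarrow> 'v set) \<Rightarrow> ('u \<times> 'v) set" where
  "graph_of S = {(u, v). v \<in> S u}"

definition inverse_op :: "('u \<Rightarrow> 'v set) \<Rightarrow> 'v \<Rightarrow> 'u set" where
  "inverse_op S v = {u. v \<in> S u}"

text \<open>Transport of an operator along identifications \<open>f\<close> and \<open>g\<close> of its source and target: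
  the graph of \<open>transport_op f g S\<close> is the image of the graph of \<open>S\<close> under \<open>f \<times> g\<close>.\<close>

definition transport_op :: "('u \<Rightarrow> 'u1) \<Rightarrow> ('v \<Rightarrow> 'v1) \<Rightarrow> ('u \<Rightarrow> 'v set) \<Rightarrow> 'u1 \<Rightarrow> 'v1 set" where
  "transport_op f g S a = {b. \<exists>u v. v \<in> S u \<and> a = f u \<and> b = g v}"

lemma graph_of_transport_op: "graph_of (transport_op f g S) = map_prod f g ` graph_of S"
  by (force simp: graph_of_def transport_op_def)

definition directed_preorder_on :: "'i set \<Rightarrow> 'i rel \<Rightarrow> bool" where
  "directed_preorder_on I r \<longleftrightarrow>
     I \<noteq> {} \<and> preorder_on I r \<and> (\<forall>i\<in>I. \<forall>j\<in>I. \<exists>k\<in>I. (i, k) \<in> r \<and> (j, k) \<in> r)"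

definition net_converges :: "'a topology \<Rightarrow> 'i set \<Rightarrow> 'i rel \<Rightarrow> ('i \<Rightarrow> 'a) \<Rightarrow> 'a \<Rightarrow> bool" where
  "net_converges T I r x l \<longleftrightarrow> l \<in> topspace T \<and>
     (\<forall>U. openin T U \<and> l \<in> U \<longrightarrow> (\<exists>i\<in>I. \<forall>j\<in>I. (i, j) \<in> r \<longrightarrow> x j \<in> U))"


section \<open>Maximal monotone operators and Gossez's type (D)\<close>

type_synonym 'y dual = "'y \<Rightarrow>\<^sub>L real"
type_synonym 'y bidual = "('y \<Rightarrow>\<^sub>L real) \<Rightarrow>\<^sub>L real"

lift_definition canonical_embedding :: "'y::banach \<Rightarrow> 'y bidual" is
  "\<lambda>y f. blinfun_apply f y"
  by (rule blinfun.bounded_linear_left)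

definition monotone_op :: "('y::banach \<Rightarrow> 'y dual set) \<Rightarrow> bool" where
  "monotone_op S \<longleftrightarrow> (\<forall>(x, x')\<in>graph_of S. \<forall>(y, y')\<in>graph_of S.
     0 \<le> blinfun_apply (x' - y') (x - y))"

definition maximal_monotone :: "('y::banach \<Rightarrow> 'y dual set) \<Rightarrow> bool" where
  "maximal_monotone S \<longleftrightarrow> monotone_op S \<and>
     (\<forall>T. monotone_op T \<and> graph_of S \<subseteq> graph_of T \<longrightarrow> graph_of T = graph_of S)"

definition bidual_monotone_op :: "('y::banach bidual \<Rightarrow> 'y dual set) \<Rightarrow> bool" where
  "bidual_monotone_op S \<longleftrightarrow> (\<forall>(x'', x')\<in>graph_of S. \<forall>(y'', y')\<in>graph_of S.
     0 \<le> blinfun_apply (x'' - y'') (x' - y'))"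

definition bidual_maximal_monotone :: "('y::banach bidual \<Rightarrow> 'y dual set) \<Rightarrow> bool" where
  "bidual_maximal_monotone S \<longleftrightarrow> bidual_monotone_op S \<and>
     (\<forall>T. bidual_monotone_op T \<and> graph_of S \<subseteq> graph_of T \<longrightarrow> graph_of T = graph_of S)"

definition maximal_monotone_bidual_extension ::
  "('y::banach \<Rightarrow> 'y dual set) \<Rightarrow> ('y bidual \<Rightarrow> 'y dual set) \<Rightarrow> bool" where
  "maximal_monotone_bidual_extension S T \<longleftrightarrow> bidual_maximal_monotone T \<and>
     (\<forall>(y, y')\<in>graph_of S. (canonical_embedding y, y') \<in> graph_of T)"

definition gossez_closure :: "('y::banach \<Rightarrow> 'y dual set) \<Rightarrow> 'y bidual \<Rightarrow> 'y dual set" where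
  "gossez_closure S y'' = {y'. \<forall>(z, z')\<in>graph_of S.
     0 \<le> blinfun_apply (y'' - canonical_embedding z) (y' - z')}"

text \<open>On \<open>'y bidual\<close>, the library's \<^const>\<open>strong_operator_topology\<close> is the topology of
  pointwise convergence on the dual space, i.e. the weak* topology \<open>\<sigma>(Y**, Y*)\<close>.\<close>

definition bidual_graph_topology :: "('y::banach bidual \<times> 'y dual) topology" where
  "bidual_graph_topology = prod_topology strong_operator_topology euclidean"

text \<open>A type cannot be quantified inside a formula, so the index sets of the nets are taken
  inside the type of sets of points of \<open>Y** \<times> Y*\<close>.  This is no restriction:
  see \<open>bounded_net_limit_reindex\<close> below.\<close>

definition type_D :: "('y::banach \<Rightarrow> 'y dual set) \<Rightarrow> bool" where
  "type_D S \<longleftrightarrow> (\<forall>(y'', y')\<in>graph_of (gossez_closure S).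
     \<exists>(I :: ('y bidual \<times> 'y dual) set set) r (p :: _ \<Rightarrow> 'y \<times> 'y dual).
       directed_preorder_on I r \<and> (\<forall>i\<in>I. p i \<in> graph_of S) \<and> bounded (p ` I) \<and>
       net_converges bidual_graph_topology I r
         (\<lambda>i. (canonical_embedding (fst (p i)), snd (p i))) (y'', y'))"

lemma bounded_net_limit_reindex:
  fixes J :: "'j set" and q :: "'j \<Rightarrow> 'b::metric_space" and h :: "'b \<Rightarrow> 'a"
  assumes J: "directed_preorder_on J s" and G: "\<forall>j\<in>J. q j \<in> G" and bd: "bounded (q ` J)"
    and lim: "net_converges T J s (\<lambda>j. h (q j)) l"
  shows "\<exists>(I :: 'a set set) r p. directed_preorder_on I r \<and> (\<forall>i\<in>I. p i \<in> G) \<and> bounded (p ` I) \<and>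
           net_converges T I r (\<lambda>i. h (p i)) l"
proof -
  define I where "I = {U. openin T U \<and> l \<in> U}"
  define r where "r = {(U, V). U \<in> I \<and> V \<in> I \<and> V \<subseteq> U}"
  have lT: "l \<in> topspace T"
    using lim by (simp add: net_converges_def)
  have ex: "\<exists>j\<in>J. h (q j) \<in> U" if "U \<in> I" for U
  proof -
    obtain j where "j \<in> J" "\<forall>k\<in>J. (j, k) \<in> s \<longrightarrow> h (q k) \<in> U"
      using lim \<open>U \<in> I\<close> unfolding net_converges_def I_def by auto
    moreover have "(j, j) \<in> s"
      using J \<open>j \<in> J\<close> unfolding directed_preorder_on_def preorder_on_def by (blast dest: refl_onD)
    ultimately show ?thesis by blast
  qed
  define f where "f U = (SOME j. j \<in> J \<and> h (q j) \<in> U)" for U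
  have f: "f U \<in> J" "h (q (f U)) \<in> U" if "U \<in> I" for U
    using someI_ex[of "\<lambda>j. j \<in> J \<and> h (q j) \<in> U"] ex[OF that] unfolding f_def by blast+
  have "topspace T \<in> I"
    using lT by (simp add: I_def)
  moreover have "preorder_on I r"
    by (auto simp: preorder_on_def refl_on_def trans_def r_def)
  moreover have "\<exists>k\<in>I. (i, k) \<in> r \<and> (j, k) \<in> r" if "i \<in> I" "j \<in> I" for i j
    using that by (intro bexI[of _ "i \<inter> j"]) (auto simp: r_def I_def)
  ultimately have "directed_preorder_on I r"
    unfolding directed_preorder_on_def by blast
  moreover have "\<forall>i\<in>I. q (f i) \<in> G"
    using f G by blast
  moreover have "bounded ((\<lambda>i. q (f i)) ` I)"
    by (rule bounded_subset[OF bd]) (use f in auto)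
  moreover have "net_converges T I r (\<lambda>i. h (q (f i))) l"
    unfolding net_converges_def
  proof (intro conjI allI impI lT)
    fix U assume "openin T U \<and> l \<in> U"
    then have "U \<in> I" by (simp add: I_def)
    then show "\<exists>i\<in>I. \<forall>j\<in>I. (i, j) \<in> r \<longrightarrow> h (q (f j)) \<in> U"
      using f by (intro bexI[of _ U]) (auto simp: r_def)
  qed
  ultimately show ?thesis
    by (intro exI[of _ I] exI[of _ r] exI[of _ "\<lambda>i. q (f i)"]) auto
qed


section \<open>The sequence spaces\<close>

text \<open>Sequences are indexed by \<open>nat\<close> starting at 0.  On a discrete space every function is
  continuous, so the library's space of bounded continuous functions on \<open>nat\<close>, with the
  supremum norm, is the space of bounded sequences.\<close>

type_synonym linf = "nat \<Rightarrow>\<^sub>C real"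

lemma mem_bcontfun_nat_iff: "(f :: nat \<Rightarrow> real) \<in> bcontfun \<longleftrightarrow> bounded (range f)"
  by (simp add: bcontfun_def continuous_on_discrete)

lemma Cauchy_linf_convergent:
  fixes f :: "nat \<Rightarrow> linf"
  assumes "Cauchy f"
  obtains g where "f \<longlonglongrightarrow> g"
proof -
  obtain g where "uniform_limit UNIV (\<lambda>n. apply_bcontfun (f n)) g sequentially"
    using assms uniformly_convergent_eq_cauchy[of "\<lambda>_. True" "\<lambda>n. apply_bcontfun (f n)"]
    unfolding Cauchy_def uniform_limit_sequentially_iff
    by (metis dist_fun_lt_imp_dist_val_lt)
  then show ?thesis
    using uniform_limit_bcontfunE[OF _ sequentially_bot] that by metis
qed

subsection \<open>Null sequences\<close>

typedef c0 = "{f :: linf. apply_bcontfun f \<longlonglongrightarrow> 0}"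
  morphisms linf_of_c0 Abs_c0
  by (rule exI[of _ 0]) simp

setup_lifting type_definition_c0

lemma linf_of_c0_tendsto: "apply_bcontfun (linf_of_c0 c) \<longlonglongrightarrow> 0"
  using linf_of_c0[of c] by simp

instantiation c0 :: real_normed_vector
begin

lift_definition zero_c0 :: c0 is "0 :: linf" by simp
lift_definition plus_c0 :: "c0 \<Rightarrow> c0 \<Rightarrow> c0" is "(+) :: linf \<Rightarrow> _"
  by (auto intro: tendsto_add_zero)
lift_definition minus_c0 :: "c0 \<Rightarrow> c0 \<Rightarrow> c0" is "(-) :: linf \<Rightarrow> _"
  using tendsto_diff by fastforce
lift_definition uminus_c0 :: "c0 \<Rightarrow> c0" is "uminus :: linf \<Rightarrow> _"
  using tendsto_minus by fastforce
lift_definition scaleR_c0 :: "real \<Rightarrow> c0 \<Rightarrow> c0" is "(*\<^sub>R) :: real \<Rightarrow> linf \<Rightarrow> _"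
  by (auto intro: tendsto_mult_right_zero)
lift_definition norm_c0 :: "c0 \<Rightarrow> real" is "norm :: linf \<Rightarrow> real" .

definition dist_c0 :: "c0 \<Rightarrow> c0 \<Rightarrow> real" where "dist_c0 x y = norm (x - y)"
definition sgn_c0 :: "c0 \<Rightarrow> c0" where "sgn_c0 x = inverse (norm x) *\<^sub>R x"
definition uniformity_c0 :: "(c0 \<times> c0) filter" where
  "uniformity_c0 = (INF e\<in>{0<..}. principal {(x, y). dist x y < e})"
definition open_c0 :: "c0 set \<Rightarrow> bool" where
  "open_c0 U = (\<forall>x\<in>U. \<forall>\<^sub>F (x', y) in uniformity. x' = x \<longrightarrow> y \<in> U)"

instance
proof
  fix x y z :: c0 and a b :: real
  show "x + y + z = x + (y + z)" by transfer (simp add: algebra_simps)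
  show "x + y = y + x" by transfer (simp add: algebra_simps)
  show "0 + x = x" by transfer simp
  show "- x + x = 0" by transfer simp
  show "x - y = x + - y" by transfer simp
  show "a *\<^sub>R (x + y) = a *\<^sub>R x + a *\<^sub>R y" by transfer (simp add: algebra_simps)
  show "(a + b) *\<^sub>R x = a *\<^sub>R x + b *\<^sub>R x" by transfer (simp add: algebra_simps)
  show "a *\<^sub>R b *\<^sub>R x = (a * b) *\<^sub>R x" by transfer simp
  show "1 *\<^sub>R x = x" by transfer simp
  show "(norm x = 0) = (x = 0)" by transfer simp
  show "norm (x + y) \<le> norm x + norm y" by transfer (rule norm_triangle_ineq)
  show "norm (a *\<^sub>R x) = \<bar>a\<bar> * norm x" by transfer simp
qed (auto simp: dist_c0_def sgn_c0_def uniformity_c0_def open_c0_def)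

end

lemma linf_of_c0_simps [simp]:
  "linf_of_c0 0 = 0"
  "linf_of_c0 (x + y) = linf_of_c0 x + linf_of_c0 y"
  "linf_of_c0 (x - y) = linf_of_c0 x - linf_of_c0 y"
  "linf_of_c0 (- x) = - linf_of_c0 x"
  "linf_of_c0 (a *\<^sub>R x) = a *\<^sub>R linf_of_c0 x"
  "norm (linf_of_c0 x) = norm x"
  by (transfer; simp)+

instance c0 :: banach
proof
  fix X :: "nat \<Rightarrow> c0" assume "Cauchy X"
  then have "Cauchy (\<lambda>n. linf_of_c0 (X n))"
    by (simp add: Cauchy_def dist_norm flip: linf_of_c0_simps(3))
  then obtain g where g: "(\<lambda>n. linf_of_c0 (X n)) \<longlonglongrightarrow> g"
    by (rule Cauchy_linf_convergent)
  have "apply_bcontfun g \<longlonglongrightarrow> 0"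
  proof (rule LIMSEQ_I)
    fix e :: real assume "0 < e"
    then obtain n where n: "norm (linf_of_c0 (X n) - g) < e / 2"
      using LIMSEQ_D[OF g, of "e / 2"] by auto
    obtain N where N: "\<And>k. k \<ge> N \<Longrightarrow> \<bar>linf_of_c0 (X n) k\<bar> < e / 2"
      using LIMSEQ_D[OF linf_of_c0_tendsto[of "X n"], of "e / 2"] \<open>0 < e\<close> by auto
    have "norm (g k - 0) < e" if "k \<ge> N" for k
      using N[OF that] n norm_bounded[of "linf_of_c0 (X n) - g" k] by simp
    then show "\<exists>N. \<forall>k\<ge>N. norm (g k - 0) < e" by blast
  qed
  then have "linf_of_c0 (Abs_c0 g) = g"
    by (simp add: Abs_c0_inverse)
  then have "(\<lambda>n. norm (X n - Abs_c0 g)) = (\<lambda>n. norm (linf_of_c0 (X n) - g))"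
    by (simp flip: linf_of_c0_simps(6))
  then have "X \<longlonglongrightarrow> Abs_c0 g"
    using tendsto_norm_zero[OF LIM_zero[OF g]] by (metis LIM_zero_cancel tendsto_norm_zero_cancel)
  then show "convergent X" by (auto simp: convergent_def)
qed


subsection \<open>Absolutely summable sequences\<close>

typedef ell1 = "{x :: nat \<Rightarrow> real. summable (\<lambda>n. \<bar>x n\<bar>)}"
  morphisms ell1_nth Abs_ell1
  by (rule exI[of _ "\<lambda>_. 0"]) simp

setup_lifting type_definition_ell1

lemma summable_abs_ell1 [simp]: "summable (\<lambda>n. \<bar>ell1_nth x n\<bar>)"
  using ell1_nth[of x] by simp

lemma summable_ell1 [simp]: "summable (ell1_nth x)"
  by (rule summable_rabs_cancel[OF summable_abs_ell1])

lemma summable_abs_add: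
  fixes x y :: "nat \<Rightarrow> real"
  assumes "summable (\<lambda>n. \<bar>x n\<bar>)" "summable (\<lambda>n. \<bar>y n\<bar>)"
  shows "summable (\<lambda>n. \<bar>x n + y n\<bar>)"
  by (rule summable_comparison_test'[OF summable_add[OF assms]]) (auto intro: abs_triangle_ineq)

instantiation ell1 :: real_normed_vector
begin

lift_definition zero_ell1 :: ell1 is "\<lambda>_. 0" by simp
lift_definition plus_ell1 :: "ell1 \<Rightarrow> ell1 \<Rightarrow> ell1" is "\<lambda>x y n. x n + y n"
  by (rule summable_abs_add)
lift_definition minus_ell1 :: "ell1 \<Rightarrow> ell1 \<Rightarrow> ell1" is "\<lambda>x y n. x n - y n"
  using summable_abs_add[of _ "\<lambda>n. - _ n"] by simp
lift_definition uminus_ell1 :: "ell1 \<Rightarrow> ell1" is "\<lambda>x n. - x n" by simp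
lift_definition scaleR_ell1 :: "real \<Rightarrow> ell1 \<Rightarrow> ell1" is "\<lambda>a x n. a * x n"
  by (simp add: abs_mult summable_mult)
lift_definition norm_ell1 :: "ell1 \<Rightarrow> real" is "\<lambda>x. \<Sum>n. \<bar>x n\<bar>" .

definition dist_ell1 :: "ell1 \<Rightarrow> ell1 \<Rightarrow> real" where "dist_ell1 x y = norm (x - y)"
definition sgn_ell1 :: "ell1 \<Rightarrow> ell1" where "sgn_ell1 x = inverse (norm x) *\<^sub>R x"
definition uniformity_ell1 :: "(ell1 \<times> ell1) filter" where
  "uniformity_ell1 = (INF e\<in>{0<..}. principal {(x, y). dist x y < e})"
definition open_ell1 :: "ell1 set \<Rightarrow> bool" where
  "open_ell1 U = (\<forall>x\<in>U. \<forall>\<^sub>F (x', y) in uniformity. x' = x \<longrightarrow> y \<in> U)"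

instance
proof
  fix x y z :: ell1 and a b :: real
  show "x + y + z = x + (y + z)" by transfer (simp add: algebra_simps)
  show "x + y = y + x" by transfer (simp add: algebra_simps)
  show "0 + x = x" by transfer simp
  show "- x + x = 0" by transfer simp
  show "x - y = x + - y" by transfer simp
  show "a *\<^sub>R (x + y) = a *\<^sub>R x + a *\<^sub>R y" by transfer (simp add: algebra_simps)
  show "(a + b) *\<^sub>R x = a *\<^sub>R x + b *\<^sub>R x" by transfer (simp add: algebra_simps)
  show "a *\<^sub>R b *\<^sub>R x = (a * b) *\<^sub>R x" by transfer (simp add: algebra_simps)
  show "1 *\<^sub>R x = x" by transfer simp
  show "(norm x = 0) = (x = 0)" by transfer (auto simp: suminf_eq_zero_iff fun_eq_iff)
  show "norm (x + y) \<le> norm x + norm y"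
  proof transfer
    fix x y :: "nat \<Rightarrow> real"
    assume *: "summable (\<lambda>n. \<bar>x n\<bar>)" "summable (\<lambda>n. \<bar>y n\<bar>)"
    have "summable (\<lambda>n. \<bar>x n + y n\<bar>)"
      by (rule summable_abs_add[OF *])
    then show "(\<Sum>n. \<bar>x n + y n\<bar>) \<le> (\<Sum>n. \<bar>x n\<bar>) + (\<Sum>n. \<bar>y n\<bar>)"
      unfolding suminf_add[OF *] by (intro suminf_le summable_add * abs_triangle_ineq)
  qed
  show "norm (a *\<^sub>R x) = \<bar>a\<bar> * norm x" by transfer (simp add: abs_mult suminf_mult)
qed (auto simp: dist_ell1_def sgn_ell1_def uniformity_ell1_def open_ell1_def)

end

lemmas ell1_nth_simps [simp] =
  zero_ell1.rep_eq plus_ell1.rep_eq minus_ell1.rep_eq uminus_ell1.rep_eq scaleR_ell1.rep_eq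

lemma ell1_eqI: "(\<And>n. ell1_nth x n = ell1_nth y n) \<Longrightarrow> x = y"
  by (metis ell1_nth_inject ext)

lemma sum_abs_le_norm_ell1: "finite F \<Longrightarrow> (\<Sum>n\<in>F. \<bar>ell1_nth x n\<bar>) \<le> norm x"
  by (simp add: norm_ell1.rep_eq sum_le_suminf)

lemma abs_ell1_nth_le_norm: "\<bar>ell1_nth x n\<bar> \<le> norm x"
  using sum_abs_le_norm_ell1[of "{n}" x] by simp

lemma ell1_of_bounded_sums:
  assumes "\<And>N. (\<Sum>n<N. \<bar>f n\<bar>) \<le> B"
  obtains x where "ell1_nth x = f" "norm x \<le> B"
proof -
  have s: "summable (\<lambda>n. \<bar>f n\<bar>)"
    by (rule bounded_imp_summable[of _ B]) (use assms[of "Suc _"] lessThan_Suc_atMost in auto)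
  then have *: "ell1_nth (Abs_ell1 f) = f" by (simp add: Abs_ell1_inverse)
  moreover have "norm (Abs_ell1 f) \<le> B"
    unfolding norm_ell1.rep_eq * using s assms by (intro suminf_le_const)
  ultimately show ?thesis using that by blast
qed

instance ell1 :: banach
proof
  fix X :: "nat \<Rightarrow> ell1" assume C: "Cauchy X"
  have "Cauchy (\<lambda>m. ell1_nth (X m) n)" for n
    unfolding Cauchy_iff
  proof (intro allI impI)
    fix e :: real assume "e > 0"
    then obtain M where "\<forall>m\<ge>M. \<forall>k\<ge>M. norm (X m - X k) < e"
      using C unfolding Cauchy_iff by blast
    then show "\<exists>M. \<forall>m\<ge>M. \<forall>k\<ge>M. norm (ell1_nth (X m) n - ell1_nth (X k) n) < e"
      using abs_ell1_nth_le_norm[of "X _ - X _" n]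
      by (metis le_less_trans minus_ell1.rep_eq real_norm_def)
  qed
  then have "\<exists>l. (\<lambda>m. ell1_nth (X m) n) \<longlonglongrightarrow> l" for n
    unfolding Cauchy_convergent_iff convergent_def .
  then obtain l where l: "\<And>n. (\<lambda>m. ell1_nth (X m) n) \<longlonglongrightarrow> l n" by metis
  have key: "\<exists>M. \<forall>m\<ge>M. \<forall>N. (\<Sum>n<N. \<bar>ell1_nth (X m) n - l n\<bar>) \<le> e" if "e > 0" for e
  proof -
    obtain M where M: "\<And>m k. m \<ge> M \<Longrightarrow> k \<ge> M \<Longrightarrow> norm (X m - X k) < e"
      using C \<open>e > 0\<close> unfolding Cauchy_iff by blast
    have "(\<Sum>n<N. \<bar>ell1_nth (X m) n - l n\<bar>) \<le> e" if "m \<ge> M" for m N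
    proof (rule LIMSEQ_le_const2)
      show "(\<lambda>k. \<Sum>n<N. \<bar>ell1_nth (X m) n - ell1_nth (X k) n\<bar>) \<longlonglongrightarrow>
              (\<Sum>n<N. \<bar>ell1_nth (X m) n - l n\<bar>)"
        by (intro tendsto_intros l)
      show "\<exists>K. \<forall>k\<ge>K. (\<Sum>n<N. \<bar>ell1_nth (X m) n - ell1_nth (X k) n\<bar>) \<le> e"
        using M[OF that] sum_abs_le_norm_ell1[of "{..<N}" "X m - X _"]
        by (intro exI[of _ M]) (fastforce intro: order_trans less_imp_le)
    qed
    then show ?thesis by blast
  qed
  obtain M where "\<And>N. (\<Sum>n<N. \<bar>ell1_nth (X M) n - l n\<bar>) \<le> 1"
    using key[of 1] by auto
  then obtain d where d: "ell1_nth d = (\<lambda>n. ell1_nth (X M) n - l n)"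
    by (rule ell1_of_bounded_sums)
  define L where "L = X M - d"
  have L: "ell1_nth L = l" by (simp add: L_def d fun_eq_iff)
  have "X \<longlonglongrightarrow> L"
  proof (rule LIMSEQ_I)
    fix e :: real assume "e > 0"
    then obtain M where M: "\<And>m N. m \<ge> M \<Longrightarrow> (\<Sum>n<N. \<bar>ell1_nth (X m) n - l n\<bar>) \<le> e / 2"
      using key[of "e / 2"] by auto
    have "norm (X m - L) < e" if "m \<ge> M" for m
    proof -
      have "norm (X m - L) \<le> e / 2"
        unfolding norm_ell1.rep_eq
        by (rule suminf_le_const) (use M[OF that] L summable_abs_ell1[of "X m - L"] in auto)
      then show ?thesis using \<open>e > 0\<close> by simp
    qed
    then show "\<exists>M. \<forall>m\<ge>M. norm (X m - L) < e" by blast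
  qed
  then show "convergent X" by (auto simp: convergent_def)
qed


section \<open>The pairing and the canonical identifications\<close>

definition seq_pairing :: "ell1 \<Rightarrow> linf \<Rightarrow> real" where
  "seq_pairing x y = (\<Sum>n. ell1_nth x n * apply_bcontfun y n)"

lemma summable_seq_pairing_abs: "summable (\<lambda>n. \<bar>ell1_nth x n * apply_bcontfun y n\<bar>)"
proof (rule summable_comparison_test'[of "\<lambda>n. \<bar>ell1_nth x n\<bar> * norm y" 0])
  show "norm \<bar>ell1_nth x n * apply_bcontfun y n\<bar> \<le> \<bar>ell1_nth x n\<bar> * norm y" for n
    using norm_bounded[of y n] by (simp add: abs_mult mult_left_mono)
qed (intro summable_mult2 summable_abs_ell1)

lemma summable_seq_pairing: "summable (\<lambda>n. ell1_nth x n * apply_bcontfun y n)"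
  by (rule summable_rabs_cancel[OF summable_seq_pairing_abs])

lemma abs_seq_pairing_le: "\<bar>seq_pairing x y\<bar> \<le> norm x * norm y"
proof -
  have "\<bar>seq_pairing x y\<bar> \<le> (\<Sum>n. \<bar>ell1_nth x n * apply_bcontfun y n\<bar>)"
    unfolding seq_pairing_def by (rule summable_rabs[OF summable_seq_pairing_abs])
  also have "\<dots> \<le> (\<Sum>n. \<bar>ell1_nth x n\<bar> * norm y)"
    using norm_bounded[of y]
    by (intro suminf_le summable_seq_pairing_abs summable_mult2 summable_abs_ell1)
       (simp add: abs_mult mult_left_mono)
  also have "\<dots> = norm x * norm y"
    by (simp add: norm_ell1.rep_eq suminf_mult2[symmetric])
  finally show ?thesis .
qed

lemma bounded_bilinear_seq_pairing: "bounded_bilinear seq_pairing"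
proof
  show "seq_pairing (x + x') y = seq_pairing x y + seq_pairing x' y" for x x' y
    using suminf_add[OF summable_seq_pairing[of x y] summable_seq_pairing[of x' y]]
    by (simp add: seq_pairing_def algebra_simps)
  show "seq_pairing x (y + y') = seq_pairing x y + seq_pairing x y'" for x y y'
    using suminf_add[OF summable_seq_pairing[of x y] summable_seq_pairing[of x y']]
    by (simp add: seq_pairing_def algebra_simps)
  show "seq_pairing (a *\<^sub>R x) y = a *\<^sub>R seq_pairing x y" for a x y
    using suminf_mult[OF summable_seq_pairing[of x y], of a]
    by (simp add: seq_pairing_def algebra_simps)
  show "seq_pairing x (a *\<^sub>R y) = a *\<^sub>R seq_pairing x y" for a x y
    using suminf_mult[OF summable_seq_pairing[of x y], of a]
    by (simp add: seq_pairing_def algebra_simps)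
  show "\<exists>K. \<forall>x y. norm (seq_pairing x y) \<le> norm x * norm y * K"
    using abs_seq_pairing_le by (intro exI[of _ 1]) auto
qed

lemma bounded_linear_linf_of_c0: "bounded_linear linf_of_c0"
  by (rule bounded_linear_intro[of _ 1]) auto

text \<open>The identifications \<open>\<ell>\<^sup>1 = (c\<^sub>0)*\<close> and \<open>\<ell>\<^sup>\<infinity> = (\<ell>\<^sup>1)*\<close>.\<close>

lift_definition c0_dual_of_ell1 :: "ell1 \<Rightarrow> c0 dual" is "\<lambda>x c. seq_pairing x (linf_of_c0 c)"
  by (rule bounded_linear_compose[OF bounded_bilinear.bounded_linear_right[OF
        bounded_bilinear_seq_pairing] bounded_linear_linf_of_c0])

lift_definition ell1_dual_of_linf :: "linf \<Rightarrow> ell1 dual" is "\<lambda>y x. seq_pairing x y"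
  by (rule bounded_bilinear.bounded_linear_left[OF bounded_bilinear_seq_pairing])

lemma c0_dual_of_ell1_diff: "c0_dual_of_ell1 (x - y) = c0_dual_of_ell1 x - c0_dual_of_ell1 y"
  by (rule blinfun_eqI) (simp add: c0_dual_of_ell1.rep_eq blinfun.diff_left
      bounded_bilinear.diff_left[OF bounded_bilinear_seq_pairing])

lemma ell1_dual_of_linf_diff:
  "ell1_dual_of_linf (x - y) = ell1_dual_of_linf x - ell1_dual_of_linf y"
  by (rule blinfun_eqI) (simp add: ell1_dual_of_linf.rep_eq blinfun.diff_left
      bounded_bilinear.diff_right[OF bounded_bilinear_seq_pairing])

lemma norm_c0_dual_of_ell1_le: "norm (c0_dual_of_ell1 x) \<le> norm x"
  by (rule norm_blinfun_bound) (use abs_seq_pairing_le[of x "linf_of_c0 _"] in \<open>auto simp: c0_dual_of_ell1.rep_eq\<close>)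

lemma norm_ell1_dual_of_linf_le: "norm (ell1_dual_of_linf y) \<le> norm y"
  by (rule norm_blinfun_bound)
     (use abs_seq_pairing_le[of _ y] in \<open>auto simp: ell1_dual_of_linf.rep_eq mult.commute\<close>)

lemma c0_of_finite_support:
  fixes f :: "nat \<Rightarrow> real"
  obtains c where "apply_bcontfun (linf_of_c0 c) = (\<lambda>n. if n < N then f n else 0)"
proof -
  let ?f = "\<lambda>n. if n < N then f n else 0"
  have lim: "?f \<longlonglongrightarrow> 0"
    by (rule tendsto_eventually) (auto simp: eventually_sequentially intro!: exI[of _ N])
  then have "bounded (range ?f)"
    using convergent_imp_bounded by blast
  then have *: "apply_bcontfun (Bcontfun ?f) = ?f"
    by (simp add: Bcontfun_inverse mem_bcontfun_nat_iff)
  then have "linf_of_c0 (Abs_c0 (Bcontfun ?f)) = Bcontfun ?f"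
    using lim by (simp add: Abs_c0_inverse)
  with * show ?thesis using that by metis
qed

lemma c0_dual_representation:
  obtains x where "c0_dual_of_ell1 x = \<phi>" "norm x \<le> norm \<phi>"
proof -
  have "\<exists>c. apply_bcontfun (linf_of_c0 c) = (\<lambda>n. if n < Suc k then (if n = k then 1 else 0) else 0)"
    for k by (rule c0_of_finite_support[where N = "Suc k" and f = "\<lambda>n. if n = k then 1 else 0"]) blast
  then obtain u where
    u0: "\<And>k. apply_bcontfun (linf_of_c0 (u k)) = (\<lambda>n. if n < Suc k then (if n = k then 1 else 0) else 0)"
    by metis
  have u: "linf_of_c0 (u k) n = (if n = k then 1 else 0)" for k n
    by (simp add: u0)
  define f where "f k = \<phi> (u k)" for k
  have sum_u: "linf_of_c0 (\<Sum>k<N. g k *\<^sub>R u k) n = (if n < N then g n else 0)" for N n g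
    by (induction N) (auto simp: u less_Suc_eq)
  have \<phi>sum: "\<phi> (\<Sum>k<N. g k *\<^sub>R u k) = (\<Sum>k<N. g k * f k)" for N g
    by (simp add: blinfun.sum_right blinfun.scaleR_right f_def)
  have "(\<Sum>k<N. \<bar>f k\<bar>) \<le> norm \<phi>" for N
  proof -
    let ?c = "\<Sum>k<N. sgn (f k) *\<^sub>R u k"
    have "norm (linf_of_c0 ?c) \<le> 1"
      by (rule norm_bound) (simp add: sum_u sgn_if)
    then have "norm ?c \<le> 1" by simp
    have "(\<Sum>k<N. \<bar>f k\<bar>) = \<phi> ?c"
      unfolding \<phi>sum by (simp add: abs_sgn mult.commute)
    also have "\<dots> \<le> norm \<phi> * norm ?c"
      using norm_blinfun[of \<phi> ?c] by simp
    also have "\<dots> \<le> norm \<phi>"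
      using \<open>norm ?c \<le> 1\<close> by (simp add: mult_left_le)
    finally show ?thesis .
  qed
  then obtain x where x: "ell1_nth x = f" and le: "norm x \<le> norm \<phi>"
    by (rule ell1_of_bounded_sums)
  have "c0_dual_of_ell1 x = \<phi>"
  proof (rule blinfun_eqI)
    fix c
    let ?s = "\<lambda>N. \<Sum>k<N. linf_of_c0 c k *\<^sub>R u k"
    have "?s \<longlonglongrightarrow> c"
    proof (rule LIMSEQ_I)
      fix e :: real assume "e > 0"
      then obtain N where N: "\<And>k. k \<ge> N \<Longrightarrow> \<bar>linf_of_c0 c k\<bar> < e / 2"
        using LIMSEQ_D[OF linf_of_c0_tendsto[of c], of "e / 2"] by auto
      have "norm (?s M - c) < e" if "M \<ge> N" for M
      proof -
        have "norm (linf_of_c0 (?s M - c)) \<le> e / 2"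
          by (rule norm_bound) (use N that \<open>e > 0\<close> in \<open>auto simp: sum_u less_imp_le\<close>)
        then have "norm (?s M - c) \<le> e / 2" by (simp only: linf_of_c0_simps(6))
        then show ?thesis using \<open>e > 0\<close> by simp
      qed
      then show "\<exists>N. \<forall>M\<ge>N. norm (?s M - c) < e" by blast
    qed
    then have "(\<lambda>N. \<phi> (?s N)) \<longlonglongrightarrow> \<phi> c"
      by (intro tendsto_intros)
    then have "(\<lambda>k. f k * linf_of_c0 c k) sums \<phi> c"
      unfolding sums_def \<phi>sum by (simp add: mult.commute)
    then show "c0_dual_of_ell1 x c = \<phi> c"
      by (simp add: c0_dual_of_ell1.rep_eq seq_pairing_def x sums_iff)
  qed
  with le show ?thesis using that by blast
qed

lemma ell1_unit:
  obtains u where "\<And>k n. ell1_nth (u k) n = (if n = k then 1 else 0)" "\<And>k. norm (u k) = 1"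
proof -
  have "(\<lambda>n. \<bar>if n = k then 1 else 0 :: real\<bar>) sums 1" for k
    using sums_single[of k "\<lambda>_. 1 :: real"] by (simp add: if_distrib cong: if_cong)
  then have "ell1_nth (Abs_ell1 (\<lambda>n. if n = k then 1 else 0)) = (\<lambda>n. if n = k then 1 else 0)"
    "(\<Sum>n. \<bar>if n = k then 1 else 0 :: real\<bar>) = 1" for k
    by (auto simp: Abs_ell1_inverse sums_iff)
  then show ?thesis
    using that[of "\<lambda>k. Abs_ell1 (\<lambda>n. if n = k then 1 else 0)"] by (simp add: norm_ell1.rep_eq)
qed

lemma ell1_dual_representation:
  obtains y where "ell1_dual_of_linf y = \<phi>" "norm y \<le> norm \<phi>"
proof -
  obtain u where u: "\<And>k n. ell1_nth (u k) n = (if n = k then 1 else 0)" and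
    nu: "\<And>k. norm (u k) = 1" by (rule ell1_unit) blast
  define f where "f k = \<phi> (u k)" for k
  have f_le: "\<bar>f k\<bar> \<le> norm \<phi>" for k
    using norm_blinfun[of \<phi> "u k"] by (simp add: f_def nu)
  then have "bounded (range f)"
    by (intro boundedI[of _ "norm \<phi>"]) auto
  then have y: "apply_bcontfun (Bcontfun f) = f"
    by (simp add: Bcontfun_inverse mem_bcontfun_nat_iff)
  have le: "norm (Bcontfun f) \<le> norm \<phi>"
    by (rule norm_bound) (simp add: y f_le)
  have "ell1_dual_of_linf (Bcontfun f) = \<phi>"
  proof (rule blinfun_eqI)
    fix x
    let ?s = "\<lambda>N. \<Sum>k<N. ell1_nth x k *\<^sub>R u k"
    have s: "ell1_nth (?s N) n = (if n < N then ell1_nth x n else 0)" for N n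
      by (induction N) (auto simp: u less_Suc_eq)
    have nrm: "norm (x - ?s N) = (\<Sum>n. \<bar>ell1_nth x (n + N)\<bar>)" for N
    proof -
      have "norm (x - ?s N) = (\<Sum>n. \<bar>ell1_nth (x - ?s N) n\<bar>)"
        by (rule norm_ell1.rep_eq)
      also have "\<dots> = (\<Sum>n. \<bar>ell1_nth (x - ?s N) (n + N)\<bar>)
                      + (\<Sum>n<N. \<bar>ell1_nth (x - ?s N) n\<bar>)"
        by (rule suminf_split_initial_segment[OF summable_abs_ell1])
      also have "\<dots> = (\<Sum>n. \<bar>ell1_nth x (n + N)\<bar>)"
        by (simp add: s)
      finally show ?thesis .
    qed
    have "(\<lambda>N. norm (x - ?s N)) \<longlonglongrightarrow> 0"
      unfolding nrm by (rule suminf_exist_split2) simp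
    then have "(\<lambda>N. norm (?s N - x)) \<longlonglongrightarrow> 0"
      by (simp only: norm_minus_commute)
    then have "?s \<longlonglongrightarrow> x"
      by (simp only: tendsto_norm_zero_iff LIM_zero_iff)
    then have "(\<lambda>N. \<phi> (?s N)) \<longlonglongrightarrow> \<phi> x"
      by (intro tendsto_intros)
    then have "(\<lambda>k. ell1_nth x k * f k) sums \<phi> x"
      unfolding sums_def by (simp add: blinfun.sum_right blinfun.scaleR_right f_def)
    then show "ell1_dual_of_linf (Bcontfun f) x = \<phi> x"
      by (simp add: ell1_dual_of_linf.rep_eq seq_pairing_def y sums_iff)
  qed
  with le show ?thesis using that by blast
qed

lemma inj_c0_dual_of_ell1: "inj c0_dual_of_ell1"
proof (rule injI, rule ell1_eqI)
  fix x y k assume eq: "c0_dual_of_ell1 x = c0_dual_of_ell1 y"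
  obtain c where c: "apply_bcontfun (linf_of_c0 c) =
      (\<lambda>n. if n < Suc k then (if n = k then 1 else 0) else 0)"
    by (rule c0_of_finite_support)
  have "(\<lambda>n. ell1_nth z n * linf_of_c0 c n) sums ell1_nth z k" for z
  proof -
    have "(\<lambda>n. ell1_nth z n * linf_of_c0 c n) = (\<lambda>n. if n = k then ell1_nth z n else 0)"
      by (auto simp: c)
    then show ?thesis
      using sums_single[of k "ell1_nth z"] by simp
  qed
  then have "c0_dual_of_ell1 z c = ell1_nth z k" for z
    by (simp add: c0_dual_of_ell1.rep_eq seq_pairing_def sums_iff)
  then show "ell1_nth x k = ell1_nth y k" using eq by metis
qed

lemma inj_ell1_dual_of_linf: "inj ell1_dual_of_linf"
proof (rule injI, rule bcontfun_eqI)
  fix x y k assume eq: "ell1_dual_of_linf x = ell1_dual_of_linf y"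
  obtain u where u: "\<And>k n. ell1_nth (u k) n = (if n = k then 1 else 0)"
    by (rule ell1_unit) blast
  have "(\<lambda>n. ell1_nth (u k) n * apply_bcontfun z n) sums z k" for z
  proof -
    have "(\<lambda>n. ell1_nth (u k) n * apply_bcontfun z n) = (\<lambda>n. if n = k then z n else 0)"
      by (auto simp: u)
    then show ?thesis
      using sums_single[of k "apply_bcontfun z"] by simp
  qed
  then have "ell1_dual_of_linf z (u k) = z k" for z
    by (simp add: ell1_dual_of_linf.rep_eq seq_pairing_def sums_iff)
  then show "apply_bcontfun x k = apply_bcontfun y k" using eq by metis
qed

lemma bij_c0_dual_of_ell1: "bij c0_dual_of_ell1"
  using inj_c0_dual_of_ell1 c0_dual_representation unfolding bij_def surj_def by metis

lemma bij_ell1_dual_of_linf: "bij ell1_dual_of_linf"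
  using inj_ell1_dual_of_linf ell1_dual_representation unfolding bij_def surj_def by metis

lemma norm_c0_dual_of_ell1: "norm (c0_dual_of_ell1 x) = norm x"
  by (metis antisym c0_dual_representation injD inj_c0_dual_of_ell1 norm_c0_dual_of_ell1_le)

lemma norm_ell1_dual_of_linf: "norm (ell1_dual_of_linf y) = norm y"
  by (metis antisym ell1_dual_representation injD inj_ell1_dual_of_linf norm_ell1_dual_of_linf_le)

lemma bounded_linear_c0_dual_of_ell1: "bounded_linear c0_dual_of_ell1"
proof (rule bounded_linear_intro[of _ 1])
  fix x y :: ell1 and a :: real
  show "c0_dual_of_ell1 (x + y) = c0_dual_of_ell1 x + c0_dual_of_ell1 y"
    by (rule blinfun_eqI) (simp add: c0_dual_of_ell1.rep_eq blinfun.add_left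
        bounded_bilinear.add_left[OF bounded_bilinear_seq_pairing])
  show "c0_dual_of_ell1 (a *\<^sub>R x) = a *\<^sub>R c0_dual_of_ell1 x"
    by (rule blinfun_eqI) (simp add: c0_dual_of_ell1.rep_eq blinfun.scaleR_left
        bounded_bilinear.scaleR_left[OF bounded_bilinear_seq_pairing])
qed (simp add: norm_c0_dual_of_ell1)

lemma bounded_linear_inv_c0_dual_of_ell1: "bounded_linear (inv c0_dual_of_ell1)"
proof -
  let ?D = c0_dual_of_ell1
  interpret D: bounded_linear ?D by (rule bounded_linear_c0_dual_of_ell1)
  have DI: "?D (inv ?D \<phi>) = \<phi>" and ID: "inv ?D (?D x) = x" for \<phi> x
    using bij_c0_dual_of_ell1 by (simp_all add: bij_def surj_f_inv_f)
  show ?thesis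
  proof (rule bounded_linear_intro[of _ 1])
    show "inv ?D (\<phi> + \<psi>) = inv ?D \<phi> + inv ?D \<psi>" for \<phi> \<psi> by (metis DI ID D.add)
    show "inv ?D (a *\<^sub>R \<phi>) = a *\<^sub>R inv ?D \<phi>" for a \<phi> by (metis DI ID D.scaleR)
    show "norm (inv ?D \<phi>) \<le> norm \<phi> * 1" for \<phi> by (metis DI norm_c0_dual_of_ell1 mult.right_neutral order_refl)
  qed
qed

text \<open>The resulting identification of \<open>\<ell>\<^sup>\<infinity>\<close> with the bidual of \<open>c\<^sub>0\<close>.\<close>

lift_definition c0_bidual_of_linf :: "linf \<Rightarrow> c0 bidual" is
  "\<lambda>y \<phi>. seq_pairing (inv c0_dual_of_ell1 \<phi>) y"
  by (rule bounded_linear_compose[OF bounded_bilinear.bounded_linear_left[OF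
        bounded_bilinear_seq_pairing] bounded_linear_inv_c0_dual_of_ell1])

lemma c0_bidual_of_linf_apply [simp]: "c0_bidual_of_linf y (c0_dual_of_ell1 x) = seq_pairing x y"
  by (simp add: c0_bidual_of_linf.rep_eq inj_c0_dual_of_ell1)

lemma c0_bidual_of_linf_of_c0: "c0_bidual_of_linf (linf_of_c0 c) = canonical_embedding c"
proof (rule blinfun_eqI)
  fix \<phi>
  obtain x where "c0_dual_of_ell1 x = \<phi>" by (rule c0_dual_representation)
  then show "c0_bidual_of_linf (linf_of_c0 c) \<phi> = canonical_embedding c \<phi>"
    by (auto simp: canonical_embedding.rep_eq c0_dual_of_ell1.rep_eq)
qed

lemma bij_c0_bidual_of_linf: "bij c0_bidual_of_linf"
proof (rule bijI)
  show "inj c0_bidual_of_linf"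
  proof (rule injI)
    fix y z assume eq: "c0_bidual_of_linf y = c0_bidual_of_linf z"
    have "ell1_dual_of_linf y = ell1_dual_of_linf z"
      by (rule blinfun_eqI) (metis eq c0_bidual_of_linf_apply ell1_dual_of_linf.rep_eq)
    then show "y = z" using inj_ell1_dual_of_linf by (auto dest: injD)
  qed
  show "surj c0_bidual_of_linf"
    unfolding surj_def
  proof
    fix \<Phi> :: "c0 bidual"
    obtain y where y: "ell1_dual_of_linf y = \<Phi> o\<^sub>L Blinfun c0_dual_of_ell1"
      by (rule ell1_dual_representation)
    have "\<Phi> = c0_bidual_of_linf y"
    proof (rule blinfun_eqI)
      fix \<phi>
      obtain x where x: "c0_dual_of_ell1 x = \<phi>" by (rule c0_dual_representation)
      have "\<Phi> \<phi> = ell1_dual_of_linf y x"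
        by (simp add: y x bounded_linear_Blinfun_apply[OF bounded_linear_c0_dual_of_ell1])
      then show "\<Phi> \<phi> = c0_bidual_of_linf y \<phi>"
        by (metis x c0_bidual_of_linf_apply ell1_dual_of_linf.rep_eq)
    qed
    then show "\<exists>y. \<Phi> = c0_bidual_of_linf y" by blast
  qed
qed


section \<open>Gossez's operator and the operator \<open>A\<close>\<close>

abbreviation ones :: linf where "ones \<equiv> const_bcontfun 1"

text \<open>The sum over all \<open>k > n\<close> is written as a sum over \<open>j = k - n - 1\<close>.\<close>

definition gossez_G :: "ell1 \<Rightarrow> linf" where
  "gossez_G x = Bcontfun (\<lambda>n. (\<Sum>j. ell1_nth x (Suc n + j)) - (\<Sum>k<n. ell1_nth x k))"

lemma gossez_G_apply:
  "apply_bcontfun (gossez_G x) n = (\<Sum>j. ell1_nth x (Suc n + j)) - (\<Sum>k<n. ell1_nth x k)"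
proof -
  let ?g = "\<lambda>n. (\<Sum>j. ell1_nth x (Suc n + j)) - (\<Sum>k<n. ell1_nth x k)"
  have "\<bar>?g n\<bar> \<le> 2 * norm x" for n
  proof -
    have s: "summable (\<lambda>j. \<bar>ell1_nth x (Suc n + j)\<bar>)"
      using summable_ignore_initial_segment[OF summable_abs_ell1[of x], of "Suc n"]
      by (simp add: add.commute)
    have "\<bar>\<Sum>j. ell1_nth x (Suc n + j)\<bar> \<le> (\<Sum>j. \<bar>ell1_nth x (Suc n + j)\<bar>)"
      by (rule summable_rabs[OF s])
    also have "(\<Sum>j. \<bar>ell1_nth x (Suc n + j)\<bar>) \<le> norm x"
      using suminf_split_initial_segment[OF summable_abs_ell1[of x], of "Suc n"]
        sum_nonneg[of "{..<Suc n}" "\<lambda>k. \<bar>ell1_nth x k\<bar>"]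
      by (simp add: norm_ell1.rep_eq add.commute)
    finally have "\<bar>\<Sum>j. ell1_nth x (Suc n + j)\<bar> \<le> norm x" .
    moreover have "\<bar>\<Sum>k<n. ell1_nth x k\<bar> \<le> norm x"
      by (rule order_trans[OF sum_abs sum_abs_le_norm_ell1]) simp
    ultimately show ?thesis by linarith
  qed
  then have "?g \<in> bcontfun"
    by (simp only: mem_bcontfun_nat_iff) (rule boundedI[of _ "2 * norm x"], auto)
  then show ?thesis
    unfolding gossez_G_def by (simp add: Bcontfun_inverse)
qed

text \<open>That the sequence below converges to 0 is part of the claim that \<open>A\<close> maps into \<open>c\<^sub>0\<close>, so
  it is not proved here; the formula for \<open>linf_of_c0 (operator_A x)\<close> depends on it.\<close>

definition operator_A :: "ell1 \<Rightarrow> c0" where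
  "operator_A x = Abs_c0 (gossez_G x + seq_pairing x ones *\<^sub>R ones)"

text \<open>The inverse of \<open>A\<close> as an operator from \<open>c\<^sub>0\<close> to \<open>\<ell>\<^sup>1\<close>.\<close>

definition A_inverse :: "c0 \<Rightarrow> ell1 set" where
  "A_inverse = inverse_op (\<lambda>x. {operator_A x})"

text \<open>The following transport operators between the sequence spaces to operators
  \<open>Y \<Rightarrow> Y*\<close> and \<open>Y** \<Rightarrow> Y*\<close> in the sense above, for \<open>Y = c\<^sub>0\<close> and for \<open>Y = \<ell>\<^sup>1\<close>.\<close>

definition to_c0_dual :: "(c0 \<Rightarrow> ell1 set) \<Rightarrow> c0 \<Rightarrow> c0 dual set" where
  "to_c0_dual = transport_op id c0_dual_of_ell1"

definition to_c0_bidual :: "(linf \<Rightarrow> ell1 set) \<Rightarrow> c0 bidual \<Rightarrow> c0 dual set" where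
  "to_c0_bidual = transport_op c0_bidual_of_linf c0_dual_of_ell1"

definition to_ell1_dual :: "(ell1 \<Rightarrow> linf set) \<Rightarrow> ell1 \<Rightarrow> ell1 dual set" where
  "to_ell1_dual = transport_op id ell1_dual_of_linf"

end

theory Submission
  imports Defs
begin

text \<open>
  With the tails \<open>T\<^sub>n = \<Sum>k\<ge>n. x\<^sub>k\<close> one has \<open>(A x)\<^sub>n = T\<^sub>n + T\<^bsub>n+1\<^esub>\<close> and
  \<open>x\<^sub>n = T\<^sub>n - T\<^bsub>n+1\<^esub>\<close>, so \<open>\<langle>x, A x\<rangle>\<close> telescopes to \<open>T\<^sub>0\<^sup>2 = \<langle>x, e\<rangle>\<^sup>2\<close>, and
  \<open>x\<^sub>0\<^sup>*\<^sup>* = e\<close> works because \<open>s - s\<^sup>2 \<le> 1/4\<close>.  Since \<open>A\<close> is linear, monotone and everywhere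
  defined, a pair in \<open>\<ell>\<^sup>1 \<times> \<ell>\<^sup>\<infinity>\<close> that is monotonically related to its graph lies on it; hence
  Gossez's closure of \<open>A\<^sup>-\<^sup>1\<close> adds no points and \<open>A\<^sup>-\<^sup>1\<close> is trivially of type (D).  For
  \<open>A : \<ell>\<^sup>1 \<rightarrow> \<ell>\<^sup>\<infinity>\<close>, a functional \<open>\<xi>\<close> on \<open>\<ell>\<^sup>\<infinity>\<close> that extends the limit gives a point \<open>(\<xi>, e)\<close>
  of the closure that no net can reach, as the range of \<open>A\<close> lies in \<open>c\<^sub>0\<close>, at distance \<open>1\<close> from \<open>e\<close>.
\<close>

section \<open>Weak* cluster points\<close>

text \<open>\<open>\<xi>\<close> is a cluster point of the sequence for pointwise convergence, by Tychonoff's theorem.\<close>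

lemma bounded_dual_sequence_limit_functional:
  fixes g :: "nat \<Rightarrow> 'y::real_normed_vector \<Rightarrow>\<^sub>L real"
  assumes B: "\<And>n. norm (g n) \<le> B"
  obtains \<xi> :: "'y \<Rightarrow>\<^sub>L real" where "\<And>y l. (\<lambda>n. g n y) \<longlonglongrightarrow> l \<Longrightarrow> \<xi> y = l"
proof -
  have g_le: "norm (g n y) \<le> norm y * B" for n y
    using norm_blinfun[of "g n" y] mult_right_mono[OF B, of "norm y" n] by (simp add: mult.commute)
  \<comment> \<open>The uniform norm bound confines all \<open>g n\<close> to a product of compact
    intervals.\<close>
  define K where "K = PiE UNIV (\<lambda>y :: 'y. cball 0 (norm y * B) :: real set)"
  have "compactin (product_topology (\<lambda>_. euclidean) UNIV) K"
    unfolding K_def by (subst compactin_PiE) auto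
  then have "compact K"
    by (simp add: euclidean_product_topology)
  define F where "F = filtermap (\<lambda>n. blinfun_apply (g n)) sequentially"
  have "eventually (\<lambda>f. f \<in> K) F"
    unfolding F_def K_def eventually_filtermap using g_le by (intro always_eventually) (simp add: PiE_iff)
  moreover have "F \<noteq> bot"
    by (simp add: F_def filtermap_bot_iff)
  ultimately obtain \<phi> where "inf (nhds \<phi>) F \<noteq> bot"
    using \<open>compact K\<close> unfolding compact_filter by blast
  \<comment> \<open>\<open>F'\<close> converges pointwise to \<open>\<phi>\<close> yet stays below
    \<open>F\<close>, so whatever holds for every \<open>g n\<close> holds eventually along it;
    linearity and the norm bound pass to \<open>\<phi>\<close> in this way.\<close>
  define F' where "F' = inf (nhds \<phi>) F"
  have F': "F' \<noteq> bot" "F' \<le> F" "F' \<le> nhds \<phi>"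
    using \<open>inf (nhds \<phi>) F \<noteq> bot\<close> by (simp_all add: F'_def)
  have eval: "((\<lambda>f. f y) \<longlongrightarrow> \<phi> y) F'" for y
  proof -
    have "((\<lambda>f. f y) \<longlongrightarrow> \<phi> y) (nhds \<phi>)"
    proof (rule topological_tendstoI)
      fix S :: "real set" assume "open S" "\<phi> y \<in> S"
      then show "\<forall>\<^sub>F f in nhds \<phi>. f y \<in> S"
        using open_vimage[OF \<open>open S\<close> continuous_on_product_coordinates[of y]]
        unfolding eventually_nhds by (intro exI[of _ "(\<lambda>f. f y) -` S"]) auto
    qed
    then show ?thesis
      using F'(3) tendsto_mono by blast
  qed
  have ev: "eventually P F'" if "\<And>n. P (blinfun_apply (g n))" for P
    by (rule filter_leD[OF F'(2)]) (simp add: F_def eventually_filtermap that)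
  have lin: "bounded_linear \<phi>"
  proof (rule bounded_linear_intro[of _ B])
    fix x y :: 'y and a :: real
    have "((\<lambda>f. f (x + y)) \<longlongrightarrow> \<phi> x + \<phi> y) F'"
      by (rule Lim_transform_eventually[OF tendsto_add[OF eval eval]])
         (rule ev, simp add: blinfun.add_right)
    then show "\<phi> (x + y) = \<phi> x + \<phi> y"
      using tendsto_unique[OF F'(1) eval] by blast
    have "((\<lambda>f. f (a *\<^sub>R x)) \<longlongrightarrow> a *\<^sub>R \<phi> x) F'"
      by (rule Lim_transform_eventually[OF tendsto_scaleR[OF tendsto_const eval]])
         (rule ev, simp add: blinfun.scaleR_right)
    then show "\<phi> (a *\<^sub>R x) = a *\<^sub>R \<phi> x"
      using tendsto_unique[OF F'(1) eval] by blast
    show "norm (\<phi> x) \<le> norm x * B"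
      by (rule tendsto_upperbound[OF tendsto_norm[OF eval] ev F'(1)]) (rule g_le)
  qed
  have "Blinfun \<phi> y = l" if "(\<lambda>n. g n y) \<longlonglongrightarrow> l" for y l
  proof -
    have "((\<lambda>f. f y) \<longlongrightarrow> l) F"
      unfolding F_def filterlim_filtermap using that .
    then have "((\<lambda>f. f y) \<longlongrightarrow> l) F'"
      using F'(2) tendsto_mono by blast
    then show ?thesis
      using tendsto_unique[OF F'(1) eval] by (simp add: bounded_linear_Blinfun_apply[OF lin])
  qed
  then show ?thesis using that by blast
qed


section \<open>Extensions to the bidual\<close>

text \<open>Points of a monotone graph are monotonically related to all its points, in particular to
  the embedded points of \<open>S\<close>.\<close>

lemma bidual_extension_subset_gossez_closure:
  assumes "bidual_monotone_op T" "\<forall>(y, y')\<in>graph_of S. (canonical_embedding y, y') \<in> graph_of T"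
  shows "graph_of T \<subseteq> graph_of (gossez_closure S)"
proof clarify
  fix y'' y' assume y: "(y'', y') \<in> graph_of T"
  have "0 \<le> blinfun_apply (y'' - canonical_embedding z) (y' - z')" if "(z, z') \<in> graph_of S" for z z'
  proof -
    have "(canonical_embedding z, z') \<in> graph_of T"
      using assms(2) that by blast
    then show ?thesis
      using assms(1) y unfolding bidual_monotone_op_def by blast
  qed
  then show "(y'', y') \<in> graph_of (gossez_closure S)"
    by (auto simp: graph_of_def[of "gossez_closure S"] gossez_closure_def)
qed

lemma graph_of_inject: "graph_of S = graph_of T \<longleftrightarrow> S = T"
  unfolding graph_of_def by (auto simp: fun_eq_iff set_eq_iff)

text \<open>The closure contains every monotone extension, so once it is itself monotone it is the
  greatest one and hence the only maximal one.\<close>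

lemma maximal_monotone_bidual_extension_iff_gossez_closure:
  assumes S: "monotone_op S" and closure: "bidual_monotone_op (gossez_closure S)"
  shows "maximal_monotone_bidual_extension S T \<longleftrightarrow> T = gossez_closure S"
proof -
  have ext: "\<forall>(y, y')\<in>graph_of S. (canonical_embedding y, y') \<in> graph_of (gossez_closure S)"
  proof clarify
    fix y y' assume y: "(y, y') \<in> graph_of S"
    have "0 \<le> blinfun_apply (canonical_embedding y - canonical_embedding z) (y' - z')"
      if "(z, z') \<in> graph_of S" for z z'
    proof -
      have "0 \<le> blinfun_apply (y' - z') (y - z)"
        using S y that unfolding monotone_op_def by blast
      then show ?thesis
        by (simp add: canonical_embedding.rep_eq blinfun.diff_left blinfun.diff_right)
    qed
    then show "(canonical_embedding y, y') \<in> graph_of (gossez_closure S)"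
      by (auto simp: graph_of_def[of "gossez_closure S"] gossez_closure_def)
  qed
  have sub: "graph_of T \<subseteq> graph_of (gossez_closure S)"
    if "bidual_monotone_op T" "\<forall>(y, y')\<in>graph_of S. (canonical_embedding y, y') \<in> graph_of T" for T
    using that by (rule bidual_extension_subset_gossez_closure)
  have "maximal_monotone_bidual_extension S (gossez_closure S)"
    unfolding maximal_monotone_bidual_extension_def bidual_maximal_monotone_def
  proof (intro conjI allI impI closure ext)
    fix T assume T: "bidual_monotone_op T \<and> graph_of (gossez_closure S) \<subseteq> graph_of T"
    then have "graph_of T \<subseteq> graph_of (gossez_closure S)"
      using ext by (intro sub) auto
    then show "graph_of T = graph_of (gossez_closure S)" using T by blast
  qed
  moreover have "T = gossez_closure S" if "maximal_monotone_bidual_extension S T"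
  proof -
    have "graph_of (gossez_closure S) = graph_of T"
      using that sub closure
      unfolding maximal_monotone_bidual_extension_def bidual_maximal_monotone_def by blast
    then show ?thesis by (simp add: graph_of_inject)
  qed
  ultimately show ?thesis by blast
qed

text \<open>Each point of the closure already comes from the graph, so constant nets
  suffice.\<close>

lemma type_D_if_gossez_closure_trivial:
  assumes "\<And>y'' y'. y' \<in> gossez_closure S y'' \<Longrightarrow> \<exists>y. y'' = canonical_embedding y \<and> y' \<in> S y"
  shows "type_D S"
  unfolding type_D_def
proof clarify
  fix y'' y' assume "(y'', y') \<in> graph_of (gossez_closure S)"
  then obtain y where y: "y'' = canonical_embedding y" "y' \<in> S y"
    using assms by (auto simp: graph_of_def)
  \<comment> \<open>A one-point index set; the empty set is just a convenient element of the index
    type.\<close>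
  define I :: "('a bidual \<times> 'a dual) set set" where "I = {{}}"
  define r :: "('a bidual \<times> 'a dual) set rel" where "r = {({}, {})}"
  have "directed_preorder_on I r"
    by (auto simp: I_def r_def directed_preorder_on_def preorder_on_def refl_on_def trans_def)
  moreover have "net_converges bidual_graph_topology I r (\<lambda>_. (y'', y')) (y'', y')"
    by (simp add: I_def net_converges_def bidual_graph_topology_def strong_operator_topology_topspace)
  ultimately show "\<exists>(I :: ('a bidual \<times> 'a dual) set set) r p. directed_preorder_on I r \<and> (\<forall>i\<in>I. p i \<in> graph_of S) \<and> bounded (p ` I) \<and>
      net_converges bidual_graph_topology I r (\<lambda>i. (canonical_embedding (fst (p i)), snd (p i))) (y'', y')"
    using y by (intro exI[of _ I] exI[of _ r] exI[of _ "\<lambda>_. (y, y')"])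
      (auto simp: I_def graph_of_def)
qed

text \<open>This is the obstruction used to refute type (D): the dual component of the net converges
  in norm.\<close>

lemma type_D_approximable:
  assumes "type_D S" "y' \<in> gossez_closure S y''" "0 < \<epsilon>"
  obtains y z' where "z' \<in> S y" "dist y' z' < \<epsilon>"
proof -
  have "(y'', y') \<in> graph_of (gossez_closure S)"
    using assms(2) by (simp add: graph_of_def)
  then obtain I :: "('a bidual \<times> 'a dual) set set" and r p where I: "directed_preorder_on I r" "\<forall>i\<in>I. p i \<in> graph_of S"
      "net_converges bidual_graph_topology I r (\<lambda>i. (canonical_embedding (fst (p i)), snd (p i))) (y'', y')"
    using assms(1) unfolding type_D_def by blast
  \<comment> \<open>The cylinder constrains only the dual component.\<close>
  have "openin bidual_graph_topology (UNIV \<times> ball y' \<epsilon>)"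
    unfolding bidual_graph_topology_def openin_prod_Times_iff
    by (metis open_ball open_openin openin_topspace strong_operator_topology_topspace)
  then obtain i where "i \<in> I" "\<forall>j\<in>I. (i, j) \<in> r \<longrightarrow> snd (p j) \<in> ball y' \<epsilon>"
    using I(3) \<open>0 < \<epsilon>\<close> unfolding net_converges_def by fastforce
  moreover have "(i, i) \<in> r"
    using I(1) \<open>i \<in> I\<close> unfolding directed_preorder_on_def preorder_on_def by (blast dest: refl_onD)
  ultimately have "snd (p i) \<in> S (fst (p i))" "dist y' (snd (p i)) < \<epsilon>"
    using I(2) by (auto simp: graph_of_def)
  then show ?thesis using that by blast
qed


section \<open>The operator \<open>A\<close>\<close>

interpretation pairing: bounded_bilinear seq_pairing
  by (rule bounded_bilinear_seq_pairing)

text \<open>The index \<open>n\<close> is included, so the first sum in \<open>gossez_G\<close> at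
  \<open>n\<close> is the tail at \<open>Suc n\<close>.\<close>

definition ell1_tail :: "ell1 \<Rightarrow> nat \<Rightarrow> real" where
  "ell1_tail x n = (\<Sum>j. ell1_nth x (j + n))"

lemma ell1_tail_eq: "ell1_tail x n = (\<Sum>k. ell1_nth x k) - (\<Sum>k<n. ell1_nth x k)"
  unfolding ell1_tail_def by (rule suminf_minus_initial_segment) simp

lemma ell1_nth_eq_tail_diff: "ell1_nth x n = ell1_tail x n - ell1_tail x (Suc n)"
  by (simp add: ell1_tail_eq)

lemma ell1_tail_0: "ell1_tail x 0 = seq_pairing x ones"
  by (simp add: ell1_tail_def seq_pairing_def)

lemma ell1_tail_tendsto: "ell1_tail x \<longlonglongrightarrow> 0"
proof -
  have "ell1_tail x \<longlonglongrightarrow> (\<Sum>k. ell1_nth x k) - (\<Sum>k. ell1_nth x k)"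
    unfolding ell1_tail_eq[abs_def] by (intro tendsto_intros summable_LIMSEQ) simp
  then show ?thesis by simp
qed

text \<open>The partial sum in \<open>gossez_G\<close> is the total minus the tail at
  \<open>n\<close>; the added multiple of \<open>ones\<close> cancels the total.\<close>

lemma gossez_G_plus_ones_nth:
  "apply_bcontfun (gossez_G x + seq_pairing x ones *\<^sub>R ones) n = ell1_tail x n + ell1_tail x (Suc n)"
  by (simp add: gossez_G_apply ell1_tail_eq[of x n] ell1_tail_0[symmetric] add.commute)
     (simp add: ell1_tail_def)

text \<open>The tails tend to \<open>0\<close>, which is the membership that \<open>Abs_c0\<close>
  in \<open>operator_A\<close> presupposes.\<close>

lemma linf_of_operator_A: "linf_of_c0 (operator_A x) = gossez_G x + seq_pairing x ones *\<^sub>R ones"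
proof -
  have "apply_bcontfun (gossez_G x + seq_pairing x ones *\<^sub>R ones) \<longlonglongrightarrow> 0"
    unfolding gossez_G_plus_ones_nth[abs_def]
    using tendsto_add[OF ell1_tail_tendsto[of x] LIMSEQ_Suc[OF ell1_tail_tendsto[of x]]] by simp
  then show ?thesis
    by (simp add: operator_A_def Abs_c0_inverse)
qed

lemma operator_A_nth: "apply_bcontfun (linf_of_c0 (operator_A x)) n = ell1_tail x n + ell1_tail x (Suc n)"
  by (simp only: linf_of_operator_A gossez_G_plus_ones_nth)

section \<open>Linearity, monotonicity and injectivity\<close>

lemma ell1_tail_add: "ell1_tail (x + y) n = ell1_tail x n + ell1_tail y n"
  unfolding ell1_tail_def by (simp add: suminf_add)

lemma ell1_tail_scaleR: "ell1_tail (a *\<^sub>R x) n = a * ell1_tail x n"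
  unfolding ell1_tail_def by (simp add: suminf_mult)

lemma linear_operator_A: "linear operator_A"
  by (rule linearI; rule linf_of_c0_inject[THEN iffD1]; rule bcontfun_eqI)
     (simp_all add: operator_A_nth ell1_tail_add ell1_tail_scaleR algebra_simps)

lemma seq_pairing_operator_A: "seq_pairing x (linf_of_c0 (operator_A x)) = (seq_pairing x ones)\<^sup>2"
proof -
  let ?T = "ell1_tail x"
  have "(\<lambda>n. (?T n)\<^sup>2) \<longlonglongrightarrow> 0\<^sup>2"
    by (rule tendsto_power[OF ell1_tail_tendsto])
  then have "(\<lambda>n. (?T n)\<^sup>2 - (?T (Suc n))\<^sup>2) sums ((?T 0)\<^sup>2 - 0\<^sup>2)"
    by (rule telescope_sums')
  moreover have "ell1_nth x n * linf_of_c0 (operator_A x) n = (?T n)\<^sup>2 - (?T (Suc n))\<^sup>2" for n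
    by (simp add: operator_A_nth ell1_nth_eq_tail_diff power2_eq_square algebra_simps)
  ultimately show ?thesis
    by (simp add: seq_pairing_def[of x "linf_of_c0 _"] sums_iff ell1_tail_0)
qed

lemma operator_A_monotone:
  "0 \<le> seq_pairing (x - y) (linf_of_c0 (operator_A x) - linf_of_c0 (operator_A y))"
  by (simp add: seq_pairing_operator_A
      flip: linf_of_c0_simps(3) linear_diff[OF linear_operator_A])

text \<open>\<open>A x = 0\<close> says that the tails of \<open>x\<close> change sign at each step; as they tend to \<open>0\<close>, they vanish.\<close>

lemma inj_operator_A: "inj operator_A"
  unfolding linear_injective_0[OF linear_operator_A]
proof (intro allI impI)
  fix x assume "operator_A x = 0"
  then have step: "ell1_tail x (Suc n) = - ell1_tail x n" for n
    using operator_A_nth[of x n] by simp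
  have "\<bar>ell1_tail x n\<bar> = \<bar>ell1_tail x 0\<bar>" for n
    by (induction n) (simp_all add: step)
  then have const: "(\<lambda>n. \<bar>ell1_tail x n\<bar>) = (\<lambda>_. \<bar>ell1_tail x 0\<bar>)"
    by blast
  have "(\<lambda>_. \<bar>ell1_tail x 0\<bar>) \<longlonglongrightarrow> 0"
    using tendsto_rabs_zero[OF ell1_tail_tendsto[of x]] unfolding const .
  then have "ell1_tail x 0 = 0"
    by (simp add: LIMSEQ_const_iff)
  then have "ell1_tail x n = 0" for n
    by (induction n) (simp_all add: step)
  then show "x = 0"
    by (intro ell1_eqI) (simp add: ell1_nth_eq_tail_diff)
qed

section \<open>The constant sequence against null sequences\<close>

lemma ones_notin_c0: "ones \<notin> range linf_of_c0"
proof
  assume "ones \<in> range linf_of_c0"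
  then obtain c where "ones = linf_of_c0 c" by blast
  then show False
    using linf_of_c0_tendsto[of c] by (simp add: LIMSEQ_const_iff flip: \<open>ones = _\<close>)
qed

lemma dist_ones_c0: "1 \<le> dist ones (linf_of_c0 c)"
proof (rule LIMSEQ_le_const2)
  show "(\<lambda>n. \<bar>1 - linf_of_c0 c n\<bar>) \<longlonglongrightarrow> 1"
    using tendsto_rabs[OF tendsto_diff[OF tendsto_const linf_of_c0_tendsto[of c]], of 1] by simp
  show "\<exists>N. \<forall>n\<ge>N. \<bar>1 - linf_of_c0 c n\<bar> \<le> dist ones (linf_of_c0 c)"
    using norm_bounded[of "ones - linf_of_c0 c"] by (simp add: dist_norm)
qed

lemma nonneg_quadratic_linear_coeff_zero:
  fixes a b :: real
  assumes "\<And>t. 0 \<le> t * a + t\<^sup>2 * b"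
  shows "a = 0"
proof -
  \<comment> \<open>Since \<open>c\<close> is positive and \<open>b - c \<le> -1\<close>, the choice
    \<open>t = - a / c\<close> makes the quadratic negative unless \<open>a = 0\<close>.\<close>
  define c where "c = \<bar>b\<bar> + 1"
  have "c > 0" by (simp add: c_def)
  have "0 \<le> c\<^sup>2 * ((- a / c) * a + (- a / c)\<^sup>2 * b)"
    using assms[of "- a / c"] by simp
  also have "\<dots> = a\<^sup>2 * (b - c)"
    using \<open>c > 0\<close> by (simp add: field_simps power2_eq_square)
  also have "\<dots> \<le> a\<^sup>2 * (- 1)"
    by (rule mult_left_mono) (auto simp: c_def)
  finally show ?thesis by simp
qed

text \<open>Minty's trick: test with \<open>x = y + t h\<close> and let \<open>t \<rightarrow> 0\<close> from both sides.\<close>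

lemma operator_A_monotonically_related_iff:
  "(\<forall>x. 0 \<le> seq_pairing (y - x) (c - linf_of_c0 (operator_A x))) \<longleftrightarrow> c = linf_of_c0 (operator_A y)"
proof
  assume rel: "\<forall>x. 0 \<le> seq_pairing (y - x) (c - linf_of_c0 (operator_A x))"
  let ?d = "c - linf_of_c0 (operator_A y)"
  have "seq_pairing h ?d = 0" for h
  proof (rule nonneg_quadratic_linear_coeff_zero)
    fix t :: real
    have "0 \<le> seq_pairing (y - (y - t *\<^sub>R h)) (c - linf_of_c0 (operator_A (y - t *\<^sub>R h)))"
      using rel by blast
    also have "\<dots> = t * seq_pairing h ?d + t\<^sup>2 * seq_pairing h (linf_of_c0 (operator_A h))"
      by (simp add: linear_diff[OF linear_operator_A] linear_scale[OF linear_operator_A]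
          pairing.scaleR_left pairing.scaleR_right pairing.diff_right pairing.add_right
          power2_eq_square algebra_simps)
    finally show "0 \<le> t * seq_pairing h ?d + t\<^sup>2 * seq_pairing h (linf_of_c0 (operator_A h))" .
  qed
  then have "ell1_dual_of_linf c = ell1_dual_of_linf (linf_of_c0 (operator_A y))"
    by (intro blinfun_eqI) (simp add: ell1_dual_of_linf.rep_eq pairing.diff_right)
  then show "c = linf_of_c0 (operator_A y)"
    by (rule injD[OF inj_ell1_dual_of_linf])
qed (use operator_A_monotone in blast)


section \<open>The inverse of \<open>A\<close> and its extension to the bidual\<close>

text \<open>The same pairs as in \<open>A_inverse\<close>, read in \<open>linf\<close>; it will turn
  out to be the unique extension to the bidual.\<close>

definition A_inverse_bidual :: "linf \<Rightarrow> ell1 set" where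
  "A_inverse_bidual = inverse_op (\<lambda>x. {linf_of_c0 (operator_A x)})"

lemma graph_A_inverse:
  "graph_of (to_c0_dual A_inverse) = range (\<lambda>x. (operator_A x, c0_dual_of_ell1 x))"
  unfolding to_c0_dual_def graph_of_transport_op
  by (auto simp: A_inverse_def inverse_op_def graph_of_def image_iff)

lemma graph_A_inverse_bidual:
  "graph_of (to_c0_bidual A_inverse_bidual) =
     range (\<lambda>x. (canonical_embedding (operator_A x), c0_dual_of_ell1 x))"
  unfolding to_c0_bidual_def graph_of_transport_op
  by (auto simp: A_inverse_bidual_def inverse_op_def graph_of_def image_iff c0_bidual_of_linf_of_c0)

lemma graph_inverse_A_inverse_bidual:
  "graph_of (to_ell1_dual (inverse_op A_inverse_bidual)) =
     range (\<lambda>x. (x, ell1_dual_of_linf (linf_of_c0 (operator_A x))))"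
  unfolding to_ell1_dual_def graph_of_transport_op
  by (auto simp: A_inverse_bidual_def inverse_op_def graph_of_def image_iff)

text \<open>Carries uniqueness of the extension from the abstract bidual back to operators on
  \<open>linf\<close>.\<close>

lemma inj_to_c0_bidual: "inj to_c0_bidual"
proof (rule injI)
  fix S T assume "to_c0_bidual S = to_c0_bidual T"
  then have "map_prod c0_bidual_of_linf c0_dual_of_ell1 ` graph_of S =
      map_prod c0_bidual_of_linf c0_dual_of_ell1 ` graph_of T"
    unfolding to_c0_bidual_def by (metis graph_of_transport_op)
  moreover have "inj (map_prod c0_bidual_of_linf c0_dual_of_ell1)"
    using bij_c0_bidual_of_linf inj_c0_dual_of_ell1 by (simp add: prod.inj_map bij_def)
  ultimately show "S = T"
    by (simp add: inj_image_eq_iff graph_of_inject)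
qed

lemma maximal_monotoneI:
  assumes "monotone_op S"
    and "\<And>y y'. (\<And>z z'. z' \<in> S z \<Longrightarrow> 0 \<le> blinfun_apply (y' - z') (y - z)) \<Longrightarrow> y' \<in> S y"
  shows "maximal_monotone S"
  unfolding maximal_monotone_def
proof (intro conjI allI impI assms(1))
  fix T assume T: "monotone_op T \<and> graph_of S \<subseteq> graph_of T"
  have "(y, y') \<in> graph_of S" if y: "(y, y') \<in> graph_of T" for y y'
  proof -
    have "0 \<le> blinfun_apply (y' - z') (y - z)" if "z' \<in> S z" for z z'
    proof -
      have "(z, z') \<in> graph_of T"
        using T that by (auto simp: graph_of_def)
      then show ?thesis
        using T y unfolding monotone_op_def by blast
    qed
    then show ?thesis
      using assms(2) by (simp add: graph_of_def)
  qed
  then show "graph_of T = graph_of S" using T by auto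
qed

section \<open>Maximality, closure and type (D) of the inverse\<close>

lemma monotone_A_inverse: "monotone_op (to_c0_dual A_inverse)"
  unfolding monotone_op_def graph_A_inverse
  using operator_A_monotone
  by (auto simp: c0_dual_of_ell1.rep_eq simp flip: c0_dual_of_ell1_diff)

lemma maximal_monotone_A_inverse: "maximal_monotone (to_c0_dual A_inverse)"
proof (rule maximal_monotoneI[OF monotone_A_inverse])
  fix c \<phi>
  assume rel: "\<And>z z'. z' \<in> to_c0_dual A_inverse z \<Longrightarrow> 0 \<le> blinfun_apply (\<phi> - z') (c - z)"
  obtain y where y: "c0_dual_of_ell1 y = \<phi>" by (rule c0_dual_representation)
  have "c0_dual_of_ell1 x \<in> to_c0_dual A_inverse (operator_A x)" for x
    using graph_A_inverse by (auto simp: graph_of_def)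
  then have "\<forall>x. 0 \<le> seq_pairing (y - x) (linf_of_c0 c - linf_of_c0 (operator_A x))"
    using rel by (metis y c0_dual_of_ell1_diff c0_dual_of_ell1.rep_eq linf_of_c0_simps(3))
  then have "c = operator_A y"
    by (simp add: operator_A_monotonically_related_iff linf_of_c0_inject)
  then show "\<phi> \<in> to_c0_dual A_inverse c"
    using graph_A_inverse y by (auto simp: graph_of_def)
qed

text \<open>The Minty argument allows an arbitrary bounded sequence as second member, so relatedness
  alone forces it into the range of \<open>A\<close>, hence into \<open>c0\<close>.\<close>

lemma gossez_closure_A_inverse:
  "gossez_closure (to_c0_dual A_inverse) = to_c0_bidual A_inverse_bidual"
proof -
  have "(\<Phi>, \<phi>) \<in> graph_of (gossez_closure (to_c0_dual A_inverse)) \<longleftrightarrow>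
      (\<Phi>, \<phi>) \<in> range (\<lambda>x. (canonical_embedding (operator_A x), c0_dual_of_ell1 x))" for \<Phi> \<phi>
  proof -
    obtain y where y: "\<Phi> = c0_bidual_of_linf y"
      using bij_c0_bidual_of_linf by (auto simp: bij_def surj_def)
    obtain x where x: "\<phi> = c0_dual_of_ell1 x" by (metis c0_dual_representation)
    have "(\<Phi>, \<phi>) \<in> graph_of (gossez_closure (to_c0_dual A_inverse)) \<longleftrightarrow>
        (\<forall>z. 0 \<le> seq_pairing (x - z) (y - linf_of_c0 (operator_A z)))"
      by (simp add: graph_of_def[of "gossez_closure _"] gossez_closure_def graph_A_inverse x y
          blinfun.diff_left pairing.diff_right flip: c0_dual_of_ell1_diff c0_bidual_of_linf_of_c0)
    also have "\<dots> \<longleftrightarrow> y = linf_of_c0 (operator_A x)"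
      by (rule operator_A_monotonically_related_iff)
    also have "\<dots> \<longleftrightarrow> \<Phi> = canonical_embedding (operator_A x)"
      using bij_c0_bidual_of_linf
      by (simp add: y bij_def inj_eq flip: c0_bidual_of_linf_of_c0)
    also have "\<dots> \<longleftrightarrow> (\<Phi>, \<phi>) \<in> range (\<lambda>x. (canonical_embedding (operator_A x), c0_dual_of_ell1 x))"
      by (auto simp: x inj_eq[OF inj_c0_dual_of_ell1])
    finally show ?thesis .
  qed
  then show ?thesis
    unfolding graph_of_inject[symmetric] graph_A_inverse_bidual by auto
qed

lemma type_D_A_inverse: "type_D (to_c0_dual A_inverse)"
proof (rule type_D_if_gossez_closure_trivial)
  fix \<Phi> \<phi> assume "\<phi> \<in> gossez_closure (to_c0_dual A_inverse) \<Phi>"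
  then have "(\<Phi>, \<phi>) \<in> graph_of (to_c0_bidual A_inverse_bidual)"
    by (simp add: gossez_closure_A_inverse graph_of_def)
  then obtain x where "\<Phi> = canonical_embedding (operator_A x)" "\<phi> = c0_dual_of_ell1 x"
    by (auto simp: graph_A_inverse_bidual)
  then show "\<exists>c. \<Phi> = canonical_embedding c \<and> \<phi> \<in> to_c0_dual A_inverse c"
    using graph_A_inverse by (auto simp: graph_of_def)
qed

lemma bidual_extension_A_inverse_iff:
  "maximal_monotone_bidual_extension (to_c0_dual A_inverse) (to_c0_bidual T) \<longleftrightarrow> T = A_inverse_bidual"
proof -
  have "bidual_monotone_op (gossez_closure (to_c0_dual A_inverse))"
    unfolding bidual_monotone_op_def gossez_closure_A_inverse graph_A_inverse_bidual
    using operator_A_monotone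
    by (auto simp: blinfun.diff_left pairing.diff_right
        simp flip: c0_dual_of_ell1_diff c0_bidual_of_linf_of_c0)
  then show ?thesis
    by (simp add: maximal_monotone_bidual_extension_iff_gossez_closure[OF monotone_A_inverse]
        gossez_closure_A_inverse inj_eq[OF inj_to_c0_bidual])
qed

section \<open>The inverse of the extension\<close>

lemma maximal_monotone_inverse_A_inverse_bidual:
  "maximal_monotone (to_ell1_dual (inverse_op A_inverse_bidual))"
proof (rule maximal_monotoneI)
  let ?S = "to_ell1_dual (inverse_op A_inverse_bidual)"
  show "monotone_op ?S"
    unfolding monotone_op_def graph_inverse_A_inverse_bidual using operator_A_monotone
    by (auto simp: ell1_dual_of_linf.rep_eq simp flip: ell1_dual_of_linf_diff)
  fix y \<phi>
  assume rel: "\<And>z z'. z' \<in> ?S z \<Longrightarrow> 0 \<le> blinfun_apply (\<phi> - z') (y - z)"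
  obtain c where c: "ell1_dual_of_linf c = \<phi>" by (rule ell1_dual_representation)
  have "ell1_dual_of_linf (linf_of_c0 (operator_A x)) \<in> ?S x" for x
    using graph_inverse_A_inverse_bidual by (auto simp: graph_of_def)
  then have "\<forall>x. 0 \<le> seq_pairing (y - x) (c - linf_of_c0 (operator_A x))"
    using rel by (metis c ell1_dual_of_linf_diff ell1_dual_of_linf.rep_eq)
  then have "c = linf_of_c0 (operator_A y)"
    by (simp add: operator_A_monotonically_related_iff)
  then show "\<phi> \<in> ?S y"
    using graph_inverse_A_inverse_bidual c by (auto simp: graph_of_def)
qed

text \<open>The unit vectors, embedded in the bidual, act as coordinate evaluations of norm at most
  \<open>1\<close>; \<open>\<xi>\<close> is a weak* cluster point of them.\<close>

lemma limit_functional_on_linf: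
  obtains \<xi> :: "ell1 bidual"
  where "\<And>y l. apply_bcontfun y \<longlonglongrightarrow> l \<Longrightarrow> \<xi> (ell1_dual_of_linf y) = l"
proof -
  obtain u where u: "\<And>k n. ell1_nth (u k) n = (if n = k then 1 else 0)" and
    nu: "\<And>k. norm (u k) = 1" by (rule ell1_unit) blast
  have "norm (canonical_embedding (u k)) \<le> 1" for k
  proof (rule norm_blinfun_bound)
    show "norm (canonical_embedding (u k) \<phi>) \<le> 1 * norm \<phi>" for \<phi>
      using norm_blinfun[of \<phi> "u k"] by (simp add: canonical_embedding.rep_eq nu)
  qed simp
  then obtain \<xi> :: "ell1 bidual"
    where \<xi>: "\<And>\<phi> l. (\<lambda>k. canonical_embedding (u k) \<phi>) \<longlonglongrightarrow> l \<Longrightarrow> \<xi> \<phi> = l"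
    using bounded_dual_sequence_limit_functional by metis
  have "canonical_embedding (u k) (ell1_dual_of_linf y) = y k" for k y
  proof -
    have "(\<lambda>n. ell1_nth (u k) n * apply_bcontfun y n) = (\<lambda>n. if n = k then y n else 0)"
      by (auto simp: u)
    then show ?thesis
      using sums_single[of k "apply_bcontfun y"]
      by (simp add: canonical_embedding.rep_eq ell1_dual_of_linf.rep_eq seq_pairing_def sums_iff)
  qed
  then show ?thesis
    by (intro that[of \<xi>] \<xi>) simp
qed

text \<open>With \<open>s = \<langle>z, e\<rangle>\<close>, the pairing of \<open>(\<xi>, e)\<close> with the graph point \<open>(z, A z)\<close> is
  \<open>1 - s + s\<^sup>2 \<ge> 0\<close>, since \<open>\<xi>\<close> is \<open>1\<close> at \<open>e\<close> and vanishes on \<open>c\<^sub>0\<close>.\<close>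

lemma not_type_D_inverse_A_inverse_bidual:
  "\<not> type_D (to_ell1_dual (inverse_op A_inverse_bidual))" (is "\<not> type_D ?S")
proof
  assume D: "type_D ?S"
  obtain \<xi> :: "ell1 bidual" where \<xi>: "\<And>y l. apply_bcontfun y \<longlonglongrightarrow> l \<Longrightarrow> \<xi> (ell1_dual_of_linf y) = l"
    by (rule limit_functional_on_linf) blast
  have "0 \<le> blinfun_apply (\<xi> - canonical_embedding z)
      (ell1_dual_of_linf ones - ell1_dual_of_linf (linf_of_c0 (operator_A z)))" for z
  proof -
    have "blinfun_apply (\<xi> - canonical_embedding z)
        (ell1_dual_of_linf ones - ell1_dual_of_linf (linf_of_c0 (operator_A z))) =
        1 - seq_pairing z ones + (seq_pairing z ones)\<^sup>2"
      using \<xi>[of ones 1] \<xi>[OF linf_of_c0_tendsto[of "operator_A z"]]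
      by (simp add: blinfun.diff_left blinfun.diff_right canonical_embedding.rep_eq
          ell1_dual_of_linf.rep_eq seq_pairing_operator_A)
    also have "\<dots> = (seq_pairing z ones - 1 / 2)\<^sup>2 + 3 / 4"
      by (simp add: power2_eq_square algebra_simps)
    finally show ?thesis by simp
  qed
  then have "ell1_dual_of_linf ones \<in> gossez_closure ?S \<xi>"
    by (auto simp: gossez_closure_def graph_inverse_A_inverse_bidual)
  \<comment> \<open>The radius \<open>1\<close> matches the lower bound for the distance from
    \<open>ones\<close> to null sequences.\<close>
  then obtain z \<phi> where z: "\<phi> \<in> ?S z" "dist (ell1_dual_of_linf ones) \<phi> < 1"
    by (rule type_D_approximable[OF D _ zero_less_one])
  then have "(z, \<phi>) \<in> graph_of ?S"
    by (simp add: graph_of_def)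
  then have "\<phi> = ell1_dual_of_linf (linf_of_c0 (operator_A z))"
    by (auto simp: graph_inverse_A_inverse_bidual)
  \<comment> \<open>The identification with the dual is isometric.\<close>
  then have "dist ones (linf_of_c0 (operator_A z)) < 1"
    using z(2) by (simp add: dist_norm norm_ell1_dual_of_linf flip: ell1_dual_of_linf_diff)
  then show False
    using dist_ones_c0 by (simp add: not_less flip: not_le)
qed

theorem proposition3p2:
  "(\<forall>x. linf_of_c0 (operator_A x) = gossez_G x + seq_pairing x ones *\<^sub>R ones) \<and>
   linear operator_A \<and>
   (\<forall>x y. 0 \<le> seq_pairing (x - y) (linf_of_c0 (operator_A x - operator_A y))) \<and>
   inj operator_A \<and>
   (\<exists>x0 :: linf. x0 \<notin> range linf_of_c0 \<and>
      (SUP x. ereal (seq_pairing x x0 - seq_pairing x (linf_of_c0 (operator_A x)))) < \<infinity>) \<and>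
   maximal_monotone (to_c0_dual A_inverse) \<and>
   type_D (to_c0_dual A_inverse) \<and>
   (\<exists>!T :: linf \<Rightarrow> ell1 set.
      maximal_monotone_bidual_extension (to_c0_dual A_inverse) (to_c0_bidual T)) \<and>
   (\<forall>T :: linf \<Rightarrow> ell1 set.
      maximal_monotone_bidual_extension (to_c0_dual A_inverse) (to_c0_bidual T) \<longrightarrow>
        maximal_monotone (to_ell1_dual (inverse_op T)) \<and>
        \<not> type_D (to_ell1_dual (inverse_op T)))"
proof (intro conjI)
  show "\<exists>x0 :: linf. x0 \<notin> range linf_of_c0 \<and>
      (SUP x. ereal (seq_pairing x x0 - seq_pairing x (linf_of_c0 (operator_A x)))) < \<infinity>"
  proof (intro exI[of _ ones] conjI)
    have "seq_pairing x ones - seq_pairing x (linf_of_c0 (operator_A x)) \<le> 1 / 4" for x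
      using zero_le_power2[of "seq_pairing x ones - 1 / 2"]
      by (simp add: seq_pairing_operator_A power2_eq_square algebra_simps)
    then have "(SUP x. ereal (seq_pairing x ones - seq_pairing x (linf_of_c0 (operator_A x))))
        \<le> ereal (1 / 4)"
      by (intro SUP_least) simp
    then show "(SUP x. ereal (seq_pairing x ones - seq_pairing x (linf_of_c0 (operator_A x)))) < \<infinity>"
      by (rule le_less_trans) simp
  qed (rule ones_notin_c0)
  show "\<forall>x y. 0 \<le> seq_pairing (x - y) (linf_of_c0 (operator_A x - operator_A y))"
    by (simp add: operator_A_monotone)
  show "\<exists>!T. maximal_monotone_bidual_extension (to_c0_dual A_inverse) (to_c0_bidual T)"
    by (simp add: bidual_extension_A_inverse_iff)
  show "\<forall>T. maximal_monotone_bidual_extension (to_c0_dual A_inverse) (to_c0_bidual T) \<longrightarrow>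
      maximal_monotone (to_ell1_dual (inverse_op T)) \<and> \<not> type_D (to_ell1_dual (inverse_op T))"
    by (simp add: bidual_extension_A_inverse_iff maximal_monotone_inverse_A_inverse_bidual
        not_type_D_inverse_A_inverse_bidual)
qed (rule allI linf_of_operator_A linear_operator_A inj_operator_A
    maximal_monotone_A_inverse type_D_A_inverse)+

end
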